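(* Let $K$ be a field, $\lambda\in K$, let $(A,\mu,\alpha_A,\beta_A,R_A)$ be a $\lambda$-Rota-Baxter BiHom-associative algebra, $M$ a vector space, $\alpha_M,\beta_M,R_M:M\to M$ three (pairwise) commuting linear maps and $\triangleright:A\otimes M\to M$, $\triangleleft:M\otimes A\to M$ two linear maps. Define a multiplication on $A\oplus M$ by $$(a+m)\cdot(a'+m')=aa'+a\triangleright m'+m\triangleleft a',\qquad a,a'\in A,\ m,m'\in M.$$ Then $(A\oplus M,\cdot,\alpha_A\oplus\alpha_M,\beta_A\oplus\beta_M,R_A\oplus R_M)$ is a $\lambda$-Rota-Baxter BiHom-associative algebra if and only if $(M,\triangleright,\triangleleft,\alpha_M,\beta_M,R_M)$ is a $\lambda$-Rota-Baxter BiHom-bimodule on $(A,\mu,\alpha_A,\beta_A,R_A)$.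
   Context: $(f\oplus g)(a+m)=f(a)+g(m)$. Everything is over the field $K$. BiHom-associative algebra $(A,\mu,\alpha,\beta)$: linear $\mu$ (written $ab$), $\alpha,\beta:A\to A$ with $\alpha\beta=\beta\alpha$, $\alpha,\beta$ multiplicative, $\alpha(a)(bc)=(ab)\beta(c)$. $\lambda$-Rota-Baxter BiHom-associative algebra $(A,\mu,\alpha,\beta,R)$: BiHom-associative algebra with linear $R$ commuting with $\alpha,\beta$ and $R(a)R(b)=R(aR(b))+R(R(a)b)+\lambda R(ab)$. Bimodule $(M,\triangleright,\triangleleft,\alpha_M,\beta_M)$: $\alpha_M\beta_M=\beta_M\alpha_M$; $f_M(a\triangleright m)=f_A(a)\triangleright f_M(m)$, $f_M(m\triangleleft a)=f_M(m)\triangleleft f_A(a)$ for $f\in\{\alpha,\beta\}$; $\alpha_A(a)\triangleright(a'\triangleright m)=(aa')\triangleright\beta_M(m)$; $\alpha_M(m)\triangleleft(aa')=(m\triangleleft a)\triangleleft\beta_A(a')$; $\alpha_A(a)\triangleright(m\triangleleft a')=(a\triangleright m)\triangleleft\beta_A(a')$. $\lambda$-Rota-Baxter BiHom-bimodule $(M,\triangleright,\triangleleft,\alpha_M,\beta_M,R_M)$: a bimodule with linear $R_M$ commuting with $\alpha_M,\beta_M$ and $R_A(a)\triangleright R_M(m)=R_M(a\triangleright R_M(m)+R_A(a)\triangleright m+\lambda a\triangleright m)$, $R_M(m)\triangleleft R_A(a)=R_M(m\triangleleft R_A(a)+R_M(m)\triangleleft a+\lambda m\triangleleft a)$. *)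

theory Defs
  imports "HOL-Analysis.Product_Vector"
begin

text \<open>A linear map $U \otimes V \to W$ is represented by the corresponding bilinear map
  \<open>U \<times> V \<rightarrow> W\<close>, in curried form.\<close>

definition bilinear_map ::
  "('k::field \<Rightarrow> 'u::ab_group_add \<Rightarrow> 'u) \<Rightarrow> ('k \<Rightarrow> 'v::ab_group_add \<Rightarrow> 'v) \<Rightarrow>
   ('k \<Rightarrow> 'w::ab_group_add \<Rightarrow> 'w) \<Rightarrow> ('u \<Rightarrow> 'v \<Rightarrow> 'w) \<Rightarrow> bool"
  where "bilinear_map sU sV sW f \<longleftrightarrow>
    (\<forall>u. Vector_Spaces.linear sV sW (\<lambda>v. f u v)) \<and>
    (\<forall>v. Vector_Spaces.linear sU sW (\<lambda>u. f u v))"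

locale bihom_associative_algebra = vector_space scale
  for scale :: "'k::field \<Rightarrow> 'a::ab_group_add \<Rightarrow> 'a" +
  fixes mult :: "'a \<Rightarrow> 'a \<Rightarrow> 'a"
    and \<alpha> \<beta> :: "'a \<Rightarrow> 'a"
  assumes mult_bilinear: "bilinear_map scale scale scale mult"
    and alpha_linear: "Vector_Spaces.linear scale scale \<alpha>"
    and beta_linear: "Vector_Spaces.linear scale scale \<beta>"
    and alpha_beta_commute: "\<alpha> \<circ> \<beta> = \<beta> \<circ> \<alpha>"
    and alpha_mult: "\<alpha> (mult a b) = mult (\<alpha> a) (\<alpha> b)"
    and beta_mult: "\<beta> (mult a b) = mult (\<beta> a) (\<beta> b)"
    and bihom_assoc: "mult (\<alpha> a) (mult b c) = mult (mult a b) (\<beta> c)"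

locale rota_baxter_bihom_associative_algebra =
  bihom_associative_algebra scale mult \<alpha> \<beta>
  for lam :: "'k::field"
    and scale :: "'k \<Rightarrow> 'a::ab_group_add \<Rightarrow> 'a"
    and mult :: "'a \<Rightarrow> 'a \<Rightarrow> 'a"
    and \<alpha> \<beta> :: "'a \<Rightarrow> 'a" +
  fixes R :: "'a \<Rightarrow> 'a"
  assumes R_linear: "Vector_Spaces.linear scale scale R"
    and R_alpha_commute: "R \<circ> \<alpha> = \<alpha> \<circ> R"
    and R_beta_commute: "R \<circ> \<beta> = \<beta> \<circ> R"
    and rota_baxter:
      "mult (R a) (R b) = R (mult a (R b)) + R (mult (R a) b) + scale lam (R (mult a b))"

locale bihom_bimodule =
  A: bihom_associative_algebra scaleA mult \<alpha>A \<beta>A + M: vector_space scaleM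
  for scaleA :: "'k::field \<Rightarrow> 'a::ab_group_add \<Rightarrow> 'a"
    and mult :: "'a \<Rightarrow> 'a \<Rightarrow> 'a"
    and \<alpha>A \<beta>A :: "'a \<Rightarrow> 'a"
    and scaleM :: "'k \<Rightarrow> 'm::ab_group_add \<Rightarrow> 'm" +
  fixes lact :: "'a \<Rightarrow> 'm \<Rightarrow> 'm"
    and ract :: "'m \<Rightarrow> 'a \<Rightarrow> 'm"
    and \<alpha>M \<beta>M :: "'m \<Rightarrow> 'm"
  assumes lact_bilinear: "bilinear_map scaleA scaleM scaleM lact"
    and ract_bilinear: "bilinear_map scaleM scaleA scaleM ract"
    and alphaM_linear: "Vector_Spaces.linear scaleM scaleM \<alpha>M"
    and betaM_linear: "Vector_Spaces.linear scaleM scaleM \<beta>M"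
    and alphaM_betaM_commute: "\<alpha>M \<circ> \<beta>M = \<beta>M \<circ> \<alpha>M"
    and alphaM_lact: "\<alpha>M (lact a m) = lact (\<alpha>A a) (\<alpha>M m)"
    and betaM_lact: "\<beta>M (lact a m) = lact (\<beta>A a) (\<beta>M m)"
    and alphaM_ract: "\<alpha>M (ract m a) = ract (\<alpha>M m) (\<alpha>A a)"
    and betaM_ract: "\<beta>M (ract m a) = ract (\<beta>M m) (\<beta>A a)"
    and lact_assoc: "lact (\<alpha>A a) (lact a' m) = lact (mult a a') (\<beta>M m)"
    and ract_assoc: "ract (\<alpha>M m) (mult a a') = ract (ract m a) (\<beta>A a')"
    and lact_ract_assoc: "lact (\<alpha>A a) (ract m a') = ract (lact a m) (\<beta>A a')"

locale rota_baxter_bihom_bimodule =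
  A: rota_baxter_bihom_associative_algebra lam scaleA mult \<alpha>A \<beta>A RA +
  bihom_bimodule scaleA mult \<alpha>A \<beta>A scaleM lact ract \<alpha>M \<beta>M
  for lam :: "'k::field"
    and scaleA :: "'k \<Rightarrow> 'a::ab_group_add \<Rightarrow> 'a"
    and mult :: "'a \<Rightarrow> 'a \<Rightarrow> 'a"
    and \<alpha>A \<beta>A RA :: "'a \<Rightarrow> 'a"
    and scaleM :: "'k \<Rightarrow> 'm::ab_group_add \<Rightarrow> 'm"
    and lact :: "'a \<Rightarrow> 'm \<Rightarrow> 'm"
    and ract :: "'m \<Rightarrow> 'a \<Rightarrow> 'm"
    and \<alpha>M \<beta>M :: "'m \<Rightarrow> 'm" +
  fixes RM :: "'m \<Rightarrow> 'm"
  assumes RM_linear: "Vector_Spaces.linear scaleM scaleM RM"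
    and RM_alphaM_commute: "RM \<circ> \<alpha>M = \<alpha>M \<circ> RM"
    and RM_betaM_commute: "RM \<circ> \<beta>M = \<beta>M \<circ> RM"
    and rota_baxter_lact:
      "lact (RA a) (RM m) = RM (lact a (RM m) + lact (RA a) m + scaleM lam (lact a m))"
    and rota_baxter_ract:
      "ract (RM m) (RA a) = RM (ract m (RA a) + ract (RM m) a + scaleM lam (ract m a))"

text \<open>The direct sum $A \oplus M$ is the product type with \<open>module_prod.scale\<close> as its scalar
  multiplication; an element $a + m$ is the pair \<open>(a, m)\<close>, and $f \oplus g$ is \<open>map_prod f g\<close>.\<close>

definition semidirect_mult ::
  "('a \<Rightarrow> 'a \<Rightarrow> 'a) \<Rightarrow> ('a \<Rightarrow> 'm \<Rightarrow> 'm) \<Rightarrow> ('m \<Rightarrow> 'a \<Rightarrow> 'm) \<Rightarrow>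
   'a \<times> 'm::ab_group_add \<Rightarrow> 'a \<times> 'm \<Rightarrow> 'a \<times> 'm"
  where "semidirect_mult mult lact ract =
    (\<lambda>(a, m) (a', m'). (mult a a', lact a m' + ract m a'))"

end

theory Submission
  imports Defs
begin

text \<open>Each axiom of the algebra \<open>A \<oplus> M\<close> is multilinear in its arguments. Restricted to arguments
  from \<open>A\<close> alone it is the corresponding axiom of \<open>A\<close>; with exactly one argument from \<open>M\<close> it is one
  of the bimodule axioms, according to the position of that argument; with two or more arguments
  from \<open>M\<close> both sides vanish.\<close>

lemma semidirect_mult_Pair [simp]:
  "semidirect_mult mult lact ract (a, m) (a', m') = (mult a a', lact a m' + ract m a')"
  by (simp add: semidirect_mult_def)

text \<open>Spelling out linearity in each slot turns additivity and homogeneity into equations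
  usable by \<open>simp\<close>. The vector space conditions appear because
  \<open>Vector_Spaces.linear\<close> contains them.\<close>

lemma bilinear_map_iff:
  "bilinear_map sU sV sW f \<longleftrightarrow> vector_space sU \<and> vector_space sV \<and> vector_space sW \<and>
    (\<forall>u v v'. f u (v + v') = f u v + f u v') \<and> (\<forall>u c v. f u (sV c v) = sW c (f u v)) \<and>
    (\<forall>u u' v. f (u + u') v = f u v + f u' v) \<and> (\<forall>c u v. f (sU c u) v = sW c (f u v))"
  by (auto simp: bilinear_map_def Vector_Spaces.linear_iff)

text \<open>By additivity at \<open>0 + 0\<close> and cancellation. This is what makes terms vanish
  when elements \<open>(a, 0)\<close> and \<open>(0, m)\<close> are substituted into the axioms of
  the direct sum.\<close>

lemma bilinear_map_zero:
  assumes "bilinear_map sU sV sW f"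
  shows bilinear_map_zero_left: "f 0 v = 0" and bilinear_map_zero_right: "f u 0 = 0"
proof -
  have "f (0 + 0) v = f 0 v + f 0 v" "f u (0 + 0) = f u 0 + f u 0"
    using assms unfolding bilinear_map_iff by blast+
  then show "f 0 v = 0" "f u 0 = 0" by simp_all
qed

lemma (in vector_space_prod) linear_map_prod:
  assumes "Vector_Spaces.linear s1 s1 f" and "Vector_Spaces.linear s2 s2 g"
  shows "Vector_Spaces.linear scale scale (map_prod f g)"
  using assms p.vector_space_axioms by (auto simp: Vector_Spaces.linear_iff scale_prod)

text \<open>Each component is a sum of bilinear maps. The second one has two summands, so a scalar
  must be distributed over them.\<close>

lemma (in vector_space_prod) bilinear_semidirect_mult:
  assumes "bilinear_map s1 s1 s1 mult" "bilinear_map s1 s2 s2 lact" "bilinear_map s2 s1 s2 ract"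
  shows "bilinear_map scale scale scale (semidirect_mult mult lact ract)"
  using assms p.vector_space_axioms
  by (auto simp: bilinear_map_iff scale_prod vs2.scale_right_distrib)

lemma (in rota_baxter_bihom_bimodule) semidirect_rota_baxter_bihom_associative_algebra:
  "rota_baxter_bihom_associative_algebra lam (module_prod.scale scaleA scaleM)
    (semidirect_mult mult lact ract)
    (map_prod \<alpha>A \<alpha>M) (map_prod \<beta>A \<beta>M) (map_prod RA RM)"
proof -
  interpret P: vector_space_prod scaleA scaleM
    by unfold_locales
  note lin = alphaM_linear betaM_linear RM_linear lact_bilinear ract_bilinear
  \<comment> \<open>These equations expand both sides of each axiom below into sums of terms with a
    single argument from \<open>M\<close>.\<close>
  note add = lin[unfolded Vector_Spaces.linear_iff bilinear_map_iff]
  show ?thesis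
  proof (intro rota_baxter_bihom_associative_algebra.intro bihom_associative_algebra.intro
      rota_baxter_bihom_associative_algebra_axioms.intro bihom_associative_algebra_axioms.intro
      P.p.vector_space_axioms)
    show "bilinear_map P.scale P.scale P.scale (semidirect_mult mult lact ract)"
      by (intro P.bilinear_semidirect_mult A.mult_bilinear lact_bilinear ract_bilinear)
    show "Vector_Spaces.linear P.scale P.scale (map_prod \<alpha>A \<alpha>M)"
      by (intro P.linear_map_prod A.alpha_linear alphaM_linear)
    show "Vector_Spaces.linear P.scale P.scale (map_prod \<beta>A \<beta>M)"
      by (intro P.linear_map_prod A.beta_linear betaM_linear)
    show "Vector_Spaces.linear P.scale P.scale (map_prod RA RM)"
      by (intro P.linear_map_prod A.R_linear RM_linear)
    show "map_prod \<alpha>A \<alpha>M \<circ> map_prod \<beta>A \<beta>M = map_prod \<beta>A \<beta>M \<circ> map_prod \<alpha>A \<alpha>M"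
      by (simp add: map_prod_compose[symmetric] A.alpha_beta_commute alphaM_betaM_commute)
    show "map_prod RA RM \<circ> map_prod \<alpha>A \<alpha>M = map_prod \<alpha>A \<alpha>M \<circ> map_prod RA RM"
      by (simp add: map_prod_compose[symmetric] A.R_alpha_commute RM_alphaM_commute)
    show "map_prod RA RM \<circ> map_prod \<beta>A \<beta>M = map_prod \<beta>A \<beta>M \<circ> map_prod RA RM"
      by (simp add: map_prod_compose[symmetric] A.R_beta_commute RM_betaM_commute)
  next
    fix x y z :: "'a \<times> 'm"
    obtain a m b n c p where [simp]: "x = (a, m)" "y = (b, n)" "z = (c, p)"
      by (metis surj_pair)
    show "map_prod \<alpha>A \<alpha>M (semidirect_mult mult lact ract x y)
        = semidirect_mult mult lact ract (map_prod \<alpha>A \<alpha>M x) (map_prod \<alpha>A \<alpha>M y)"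
      by (simp add: A.alpha_mult add alphaM_lact alphaM_ract)
    show "map_prod \<beta>A \<beta>M (semidirect_mult mult lact ract x y)
        = semidirect_mult mult lact ract (map_prod \<beta>A \<beta>M x) (map_prod \<beta>A \<beta>M y)"
      by (simp add: A.beta_mult add betaM_lact betaM_ract)
    show "semidirect_mult mult lact ract (map_prod \<alpha>A \<alpha>M x) (semidirect_mult mult lact ract y z)
        = semidirect_mult mult lact ract (semidirect_mult mult lact ract x y) (map_prod \<beta>A \<beta>M z)"
      \<comment> \<open>The \<open>M\<close>-component has three terms on each side, containing
        \<open>p\<close>, \<open>n\<close> and \<open>m\<close> respectively;
        \<open>lact_assoc\<close>, \<open>lact_ract_assoc\<close> and \<open>ract_assoc\<close>
        match them in this order. Only the bracketing of the sum differs.\<close>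
      by (simp add: A.bihom_assoc add lact_assoc ract_assoc lact_ract_assoc add.assoc)
    show "semidirect_mult mult lact ract (map_prod RA RM x) (map_prod RA RM y)
        = map_prod RA RM (semidirect_mult mult lact ract x (map_prod RA RM y))
        + map_prod RA RM (semidirect_mult mult lact ract (map_prod RA RM x) y)
        + P.scale lam (map_prod RA RM (semidirect_mult mult lact ract x y))"
      \<comment> \<open>The bimodule laws have \<open>lam\<close> inside \<open>RM\<close>, the
        algebra law has it outside; linearity of \<open>RM\<close> reconciles them. The six
        resulting summands then agree up to order.\<close>
      by (simp add: A.rota_baxter rota_baxter_lact rota_baxter_ract add P.scale_prod
          M.scale_right_distrib algebra_simps)
  qed
qed

theorem proposition2p22:
  fixes lam :: "'k::field"
    and scaleA :: "'k \<Rightarrow> 'a::ab_group_add \<Rightarrow> 'a"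
    and mult :: "'a \<Rightarrow> 'a \<Rightarrow> 'a"
    and \<alpha>A \<beta>A RA :: "'a \<Rightarrow> 'a"
    and scaleM :: "'k \<Rightarrow> 'm::ab_group_add \<Rightarrow> 'm"
    and lact :: "'a \<Rightarrow> 'm \<Rightarrow> 'm"
    and ract :: "'m \<Rightarrow> 'a \<Rightarrow> 'm"
    and \<alpha>M \<beta>M RM :: "'m \<Rightarrow> 'm"
  assumes "rota_baxter_bihom_associative_algebra lam scaleA mult \<alpha>A \<beta>A RA"
    and "vector_space scaleM"
    and "Vector_Spaces.linear scaleM scaleM \<alpha>M"
    and "Vector_Spaces.linear scaleM scaleM \<beta>M"
    and "Vector_Spaces.linear scaleM scaleM RM"
    and "\<alpha>M \<circ> \<beta>M = \<beta>M \<circ> \<alpha>M"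
    and "RM \<circ> \<alpha>M = \<alpha>M \<circ> RM"
    and "RM \<circ> \<beta>M = \<beta>M \<circ> RM"
    and "bilinear_map scaleA scaleM scaleM lact"
    and "bilinear_map scaleM scaleA scaleM ract"
  shows "rota_baxter_bihom_associative_algebra lam (module_prod.scale scaleA scaleM)
      (semidirect_mult mult lact ract)
      (map_prod \<alpha>A \<alpha>M) (map_prod \<beta>A \<beta>M) (map_prod RA RM)
    \<longleftrightarrow> rota_baxter_bihom_bimodule lam scaleA mult \<alpha>A \<beta>A RA scaleM lact ract \<alpha>M \<beta>M RM"
proof
  assume "rota_baxter_bihom_bimodule lam scaleA mult \<alpha>A \<beta>A RA scaleM lact ract \<alpha>M \<beta>M RM"
  then show "rota_baxter_bihom_associative_algebra lam (module_prod.scale scaleA scaleM)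
      (semidirect_mult mult lact ract)
      (map_prod \<alpha>A \<alpha>M) (map_prod \<beta>A \<beta>M) (map_prod RA RM)"
    by (rule rota_baxter_bihom_bimodule.semidirect_rota_baxter_bihom_associative_algebra)
next
  assume "rota_baxter_bihom_associative_algebra lam (module_prod.scale scaleA scaleM)
      (semidirect_mult mult lact ract)
      (map_prod \<alpha>A \<alpha>M) (map_prod \<beta>A \<beta>M) (map_prod RA RM)"
  then interpret S: rota_baxter_bihom_associative_algebra lam "module_prod.scale scaleA scaleM"
    "semidirect_mult mult lact ract" "map_prod \<alpha>A \<alpha>M" "map_prod \<beta>A \<beta>M" "map_prod RA RM" .
  interpret A: rota_baxter_bihom_associative_algebra lam scaleA mult \<alpha>A \<beta>A RA
    by (fact assms)
  interpret M: vector_space scaleM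
    by (fact assms)
  interpret P: vector_space_prod scaleA scaleM
    by unfold_locales
  \<comment> \<open>With these rules, substituting elements having one zero component reduces the
    \<open>A\<close>-component of an axiom to a triviality or an axiom of \<open>A\<close>, and
    leaves one term of each kind in the \<open>M\<close>-component.\<close>
  note [simp] =
    bilinear_map_zero[OF assms(9)] bilinear_map_zero[OF assms(10)]
    bilinear_map_zero[OF A.mult_bilinear]
    module_hom.zero[OF module_hom_linearI[OF assms(3)]]
    module_hom.zero[OF module_hom_linearI[OF assms(4)]]
    module_hom.zero[OF module_hom_linearI[OF assms(5)]]
    module_hom.zero[OF module_hom_linearI[OF A.R_linear]]
    module_hom.zero[OF module_hom_linearI[OF A.alpha_linear]]
    module_hom.zero[OF module_hom_linearI[OF A.beta_linear]]
  note RM_add = assms(5)[unfolded Vector_Spaces.linear_iff]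
  show "rota_baxter_bihom_bimodule lam scaleA mult \<alpha>A \<beta>A RA scaleM lact ract \<alpha>M \<beta>M RM"
  \<comment> \<open>The assumptions settle linearity and commutation, so only the nine compatibility
    equations remain.\<close>
  proof (intro rota_baxter_bihom_bimodule.intro rota_baxter_bihom_bimodule_axioms.intro
      bihom_bimodule.intro bihom_bimodule_axioms.intro assms A.bihom_associative_algebra_axioms)
    fix a a' :: 'a and m :: 'm
    show "\<alpha>M (lact a m) = lact (\<alpha>A a) (\<alpha>M m)"
      using S.alpha_mult[of "(a, 0)" "(0, m)"] by simp
    show "\<beta>M (lact a m) = lact (\<beta>A a) (\<beta>M m)"
      using S.beta_mult[of "(a, 0)" "(0, m)"] by simp
    show "\<alpha>M (ract m a) = ract (\<alpha>M m) (\<alpha>A a)"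
      using S.alpha_mult[of "(0, m)" "(a, 0)"] by simp
    show "\<beta>M (ract m a) = ract (\<beta>M m) (\<beta>A a)"
      using S.beta_mult[of "(0, m)" "(a, 0)"] by simp
    show "lact (\<alpha>A a) (lact a' m) = lact (mult a a') (\<beta>M m)"
      using S.bihom_assoc[of "(a, 0)" "(a', 0)" "(0, m)"] by simp
    show "ract (\<alpha>M m) (mult a a') = ract (ract m a) (\<beta>A a')"
      using S.bihom_assoc[of "(0, m)" "(a, 0)" "(a', 0)"] by simp
    show "lact (\<alpha>A a) (ract m a') = ract (lact a m) (\<beta>A a')"
      using S.bihom_assoc[of "(a, 0)" "(0, m)" "(a', 0)"] by simp
    show "lact (RA a) (RM m) = RM (lact a (RM m) + lact (RA a) m + scaleM lam (lact a m))"
      \<comment> \<open>The instance yields three separate values of \<open>RM\<close>; linearity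
        splits the goal into the same three.\<close>
      using S.rota_baxter[of "(a, 0)" "(0, m)"] by (simp add: P.scale_prod RM_add)
    show "ract (RM m) (RA a) = RM (ract m (RA a) + ract (RM m) a + scaleM lam (ract m a))"
      using S.rota_baxter[of "(0, m)" "(a, 0)"] by (simp add: P.scale_prod RM_add)
  qed
qed

end
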